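(* Let $\Sigma$ be a finite alphabet and let $W\in\Sigma^\infty$ be a computable infinite word such that every word in $\Sigma^*$ is a factor of $W$. Then the Büchi realizability problem $\mathrm{R}_p^\infty(W)$ is decidable.
   Context: An infinite word over $\Sigma$ is a sequence $W=w_1w_2\ldots w_n\ldots$ of symbols of $\Sigma$; it is computable if $n\mapsto w_n$ is computable. A factor of $W$ is a finite word of the form $w_nw_{n+1}\ldots w_m$ (the empty word is also regarded as a factor). $\mathrm{Pref}(W)\subseteq\Sigma^*$ is the set of all finite prefixes $w_1\ldots w_n$ of $W$. The Büchi realizability problem $\mathrm{R}_p^\infty(W)$: given a regular language $R\subseteq\Sigma^*$ (described by a deterministic finite automaton recognizing it), decide whether $|R\cap\mathrm{Pref}(W)|=\infty$. *)

theory Defs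
  imports Main "HOL-Library.Nat_Bijection" "HOL-Library.Omega_Words_Fun"
begin

section \<open>Partial recursive functions\<close>

datatype recf =
    Zero
  | Succ
  | Proj nat
  | Comp recf "recf list"
  | PrimRec recf recf
  | Mu recf

text \<open>\<open>evaluates p xs y\<close>: the program \<open>p\<close> halts on the arguments \<open>xs\<close> with the result \<open>y\<close>.
  Minimization requires the body to be defined at all arguments below the first zero.\<close>

inductive evaluates :: "recf \<Rightarrow> nat list \<Rightarrow> nat \<Rightarrow> bool" where
  Zero: "evaluates Zero xs 0"
| Succ: "evaluates Succ [x] (Suc x)"
| Proj: "i < length xs \<Longrightarrow> evaluates (Proj i) xs (xs ! i)"
| Comp: "list_all2 (\<lambda>g y. evaluates g xs y) gs ys \<Longrightarrow> evaluates f ys z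
    \<Longrightarrow> evaluates (Comp f gs) xs z"
| PrimRec_0: "evaluates f xs y \<Longrightarrow> evaluates (PrimRec f g) (0 # xs) y"
| PrimRec_Suc: "evaluates (PrimRec f g) (n # xs) y \<Longrightarrow> evaluates g (n # y # xs) z
    \<Longrightarrow> evaluates (PrimRec f g) (Suc n # xs) z"
| Mu: "evaluates f (n # xs) 0 \<Longrightarrow> \<forall>i<n. \<exists>y. evaluates f (i # xs) (Suc y)
    \<Longrightarrow> evaluates (Mu f) xs n"

inductive_cases evaluates_elims:
  "evaluates Zero xs y"
  "evaluates Succ xs y"
  "evaluates (Proj i) xs y"
  "evaluates (Comp f gs) xs y"
  "evaluates (PrimRec f g) (0 # xs) y"
  "evaluates (PrimRec f g) (Suc n # xs) y"
  "evaluates (Mu f) xs y"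

lemma evaluates_deterministic: "evaluates p xs y \<Longrightarrow> evaluates p xs z \<Longrightarrow> y = z"
proof (induction arbitrary: z rule: evaluates.induct)
  case (Comp xs gs ys f z z')
  from Comp.prems obtain ys' where
    ys': "list_all2 (\<lambda>g y. evaluates g xs y) gs ys'" "evaluates f ys' z'"
    by (blast elim: evaluates_elims)
  have "ys = ys'"
    using Comp.IH(1) ys'(1)
    by (intro nth_equalityI) (auto simp: list_all2_conv_all_nth)
  with Comp.IH(2) ys'(2) show ?case by simp
next
  case (PrimRec_Suc f g n xs y z z')
  from PrimRec_Suc.prems obtain y' where
    "evaluates (PrimRec f g) (n # xs) y'" "evaluates g (n # y' # xs) z'"
    by (blast elim: evaluates_elims)
  with PrimRec_Suc.IH show ?case by metis
next
  case (Mu f n xs m)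
  from Mu.prems have m: "evaluates f (m # xs) 0" "\<forall>i<m. \<exists>y. evaluates f (i # xs) (Suc y)"
    by (blast elim: evaluates_elims)+
  have "\<not> m < n" using Mu.IH(2) m(1) by blast
  moreover have "\<not> n < m" using Mu.IH(1) m(2) by blast
  ultimately show ?case by simp
qed (blast elim: evaluates_elims)+

definition computable :: "(nat \<Rightarrow> nat) \<Rightarrow> bool" where
  "computable f \<longleftrightarrow> (\<exists>p. \<forall>n. evaluates p [n] (f n))"

definition decidable :: "nat set \<Rightarrow> bool" where
  "decidable A \<longleftrightarrow> computable (\<lambda>n. if n \<in> A then 1 else 0)"


section \<open>Infinite words\<close>

text \<open>Letters are presented to programs by their position in a list \<open>as\<close> enumerating the
  alphabet. Words are indexed from \<open>0\<close>.\<close>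

definition computable_word :: "'a list \<Rightarrow> 'a word \<Rightarrow> bool" where
  "computable_word as W \<longleftrightarrow>
     (\<exists>f. computable f \<and> (\<forall>n. f n < length as \<and> W n = as ! f n))"

definition factor :: "'a list \<Rightarrow> 'a word \<Rightarrow> bool" where
  "factor u W \<longleftrightarrow> (\<exists>i j. u = W[i \<rightarrow> j])"

definition Pref :: "'a word \<Rightarrow> 'a list set" where
  "Pref W = {prefix n W | n. True}"


section \<open>Deterministic finite automata\<close>

text \<open>The states are \<open>0, \<dots>, nstates M - 1\<close>.\<close>

record 'a dfa =
  nstates :: nat
  init :: nat
  delta :: "nat \<Rightarrow> 'a \<Rightarrow> nat"
  final :: "nat set"

definition is_dfa :: "'a set \<Rightarrow> 'a dfa \<Rightarrow> bool" where
  "is_dfa \<Sigma> M \<longleftrightarrow> init M < nstates M \<and> final M \<subseteq> {..<nstates M} \<and>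
     (\<forall>q<nstates M. \<forall>a\<in>\<Sigma>. delta M q a < nstates M)"

definition lang :: "'a set \<Rightarrow> 'a dfa \<Rightarrow> 'a list set" where
  "lang \<Sigma> M = {u \<in> lists \<Sigma>. foldl (delta M) (init M) u \<in> final M}"

text \<open>The number of states, the initial state, the rows of the transition table, and the
  characteristic list of the set of final states.\<close>

definition dfa_code :: "'a list \<Rightarrow> 'a dfa \<Rightarrow> nat" where
  "dfa_code as M = list_encode
     [nstates M,
      init M,
      list_encode (map (\<lambda>q. list_encode (map (delta M q) as)) [0..<nstates M]),
      list_encode (map (\<lambda>q. if q \<in> final M then 1 else 0) [0..<nstates M])]"

lemma list_encode_eq_iff: "list_encode xs = list_encode ys \<longleftrightarrow> xs = ys"
  by (metis list_encode_inverse)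

lemma dfa_code_determines_lang:
  assumes "is_dfa (set as) M" "is_dfa (set as) M'" "dfa_code as M = dfa_code as M'"
  shows "lang (set as) M = lang (set as) M'"
proof -
  have n: "nstates M = nstates M'" and i: "init M = init M'"
    and t: "\<And>q a. q < nstates M \<Longrightarrow> a \<in> set as \<Longrightarrow> delta M q a = delta M' q a"
    using assms(3) unfolding dfa_code_def by (auto simp: list_encode_eq_iff)
  have f: "q \<in> final M \<longleftrightarrow> q \<in> final M'" if "q < nstates M" for q
  proof -
    have "map (\<lambda>q. if q \<in> final M then 1 else 0 :: nat) [0..<nstates M] =
          map (\<lambda>q. if q \<in> final M' then 1 else 0) [0..<nstates M']"
      using assms(3) unfolding dfa_code_def list_encode_eq_iff list.inject by blast
    from arg_cong[OF this, of "\<lambda>xs. xs ! q"] that n show ?thesis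
      by (simp split: if_splits)
  qed
  have run: "foldl (delta M) q u = foldl (delta M') q u \<and> foldl (delta M) q u < nstates M"
    if "u \<in> lists (set as)" "q < nstates M" for q u
    using that
  proof (induction u arbitrary: q)
    case (Cons a u)
    then have "delta M q a < nstates M" "delta M' q a = delta M q a"
      using assms(1) t by (auto simp: is_dfa_def)
    with Cons.IH[of "delta M q a"] Cons.prems Cons.hyps show ?case by auto
  qed simp
  have init: "init M < nstates M"
    using assms(1) by (simp add: is_dfa_def)
  have "foldl (delta M) (init M) u \<in> final M \<longleftrightarrow> foldl (delta M') (init M') u \<in> final M'"
    if "u \<in> lists (set as)" for u
    using run[OF that init] f i by metis
  then show ?thesis
    unfolding lang_def by blast
qed


section \<open>Buechi realizability\<close>

definition buchi_realizable :: "'a word \<Rightarrow> 'a list set \<Rightarrow> bool" where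
  "buchi_realizable W R \<longleftrightarrow> infinite (R \<inter> Pref W)"

text \<open>The set of codes of the positive instances.\<close>

definition buchi_realizability_problem :: "'a list \<Rightarrow> 'a word \<Rightarrow> nat set" where
  "buchi_realizability_problem as W =
     {dfa_code as M | M. is_dfa (set as) M \<and> buchi_realizable W (lang (set as) M)}"

end

theory Submission
  imports Defs
begin

text \<open>Prepending long words to \<open>u\<close> shows that every \<open>u\<close> occurs in \<open>W\<close> infinitely often.
  Let \<open>q\<^sub>n\<close> be the state of the automaton after \<open>n\<close> letters of \<open>W\<close>, and call a state dead if no
  final state is reachable from it. Some word leads every state to one that is dead or cannot reach
  a dead state; since it occurs in \<open>W\<close>, some \<open>q\<^sub>n\<close> is of this kind. If \<open>q\<^sub>n\<close> is dead, then no final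
  state is visited after time \<open>n\<close>. If \<open>q\<^sub>n\<close> cannot reach a dead state, then some word makes each
  state reachable from \<open>q\<^sub>n\<close> pass through a final state, and it occurs infinitely often, so final
  states are visited infinitely often. Both cases are witnessed by a rank function on the states
  that is checked by bounded quantification, so an unbounded search decides which one occurs.\<close>

section \<open>Closure properties of recursive functions\<close>

text \<open>Arguments are passed as an environment of which a program reads a finite initial segment.
  A binder puts its variable at index \<open>0\<close> and shifts the others, so that unfolding a definition
  by introduction rules always leaves goals in which the environment occurs applied to an index.\<close>

definition recursive :: "((nat \<Rightarrow> nat) \<Rightarrow> nat) \<Rightarrow> bool" where
  "recursive f \<longleftrightarrow> (\<exists>k p. \<forall>e. evaluates p (map e [0..<k]) (f e))"

definition recursive_pred :: "((nat \<Rightarrow> nat) \<Rightarrow> bool) \<Rightarrow> bool" where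
  "recursive_pred P \<longleftrightarrow> recursive (\<lambda>e. if P e then 1 else 0)"

lemma evaluates_Comp_map:
  assumes "\<And>i. i < k \<Longrightarrow> evaluates (p i) xs (y i)" and "evaluates q (map y [0..<k]) z"
  shows "evaluates (Comp q (map p [0..<k])) xs z"
  using assms by (intro evaluates.Comp) (auto simp: list_all2_conv_all_nth)

text \<open>Composing with the projections to the first \<open>k\<close> arguments turns a program
  that reads \<open>k\<close> arguments into one that reads any longer prefix of the environment.
  Several programs can thus be brought to a common number of arguments.\<close>

lemma recursive_eventually:
  assumes "recursive f"
  shows "\<exists>k. \<forall>l\<ge>k. \<exists>p. \<forall>e. evaluates p (map e [0..<l]) (f e)"
proof -
  obtain k p where p: "\<And>e. evaluates p (map e [0..<k]) (f e)"
    using assms unfolding recursive_def by blast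
  have "evaluates (Comp p (map Proj [0..<k])) (map e [0..<l]) (f e)" if "k \<le> l" for l e
  proof (rule evaluates_Comp_map)
    show "evaluates (Proj i) (map e [0..<l]) (e i)" if "i < k" for i
      using evaluates.Proj[of i "map e [0..<l]"] that \<open>k \<le> l\<close> by simp
  qed (rule p)
  then show ?thesis by blast
qed

text \<open>The program for \<open>h\<close> reads only \<open>k\<close> entries, so only finitely
  many of the functions \<open>s i\<close> have to be computed, and these have a common prefix
  length.\<close>

lemma recursive_subst:
  assumes "recursive h" and "\<And>i. recursive (s i)"
  shows "recursive (\<lambda>e. h (\<lambda>i. s i e))"
proof -
  obtain k q where q: "\<And>e. evaluates q (map e [0..<k]) (h e)"
    using assms(1) unfolding recursive_def by blast
  obtain K where K: "\<And>i l. l \<ge> K i \<Longrightarrow> \<exists>p. \<forall>e. evaluates p (map e [0..<l]) (s i e)"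
    using recursive_eventually[OF assms(2)] by metis
  define l where "l = Max (K ` {..<k})"
  have "K i \<le> l" if "i < k" for i
    using that unfolding l_def by simp
  then have "\<forall>i. \<exists>p. i < k \<longrightarrow> (\<forall>e. evaluates p (map e [0..<l]) (s i e))"
    using K by blast
  then obtain p where p: "\<And>i e. i < k \<Longrightarrow> evaluates (p i) (map e [0..<l]) (s i e)"
    by metis
  have "evaluates (Comp q (map p [0..<k])) (map e [0..<l]) (h (\<lambda>i. s i e))" for e
    using p q by (rule evaluates_Comp_map)
  then show ?thesis unfolding recursive_def by blast
qed

lemma recursive_var: "recursive (\<lambda>e. e i)"
  unfolding recursive_def
proof (intro exI allI)
  show "evaluates (Proj i) (map e [0..<Suc i]) (e i)" for e
    using evaluates.Proj[of i "map e [0..<Suc i]"] by (simp del: upt_Suc)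
qed

lemma recursive_subst1:
  assumes "recursive (\<lambda>e. h (e 0))" "recursive f"
  shows "recursive (\<lambda>e. h (f e))"
  using recursive_subst[of "\<lambda>e. h (e 0)" "\<lambda>i. f"] assms by simp

lemma recursive_subst2:
  assumes "recursive (\<lambda>e. h (e 0) (e 1))" "recursive f" "recursive g"
  shows "recursive (\<lambda>e. h (f e) (g e))"
  using recursive_subst[of "\<lambda>e. h (e 0) (e 1)" "\<lambda>i. if i = 0 then f else g"] assms by simp

lemma recursive_Suc: "recursive f \<Longrightarrow> recursive (\<lambda>e. Suc (f e))"
proof (rule recursive_subst1[of Suc])
  have "evaluates Succ (map e [0..<1]) (Suc (e 0))" for e
    by (simp add: evaluates.Succ)
  then show "recursive (\<lambda>e. Suc (e 0))" unfolding recursive_def by blast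
qed assumption+

lemma recursive_const: "recursive (\<lambda>e. c)"
proof (induction c)
  case 0
  then show ?case unfolding recursive_def using evaluates.Zero by blast
qed (rule recursive_Suc)

lemma map_upt_Suc_env: "map e [0..<Suc k] = e 0 # map (\<lambda>i. e (Suc i)) [0..<k]"
  by (simp add: map_upt_Suc del: upt_Suc)

text \<open>\<open>PrimRec\<close> passes the counter and the previous value in front of the
  parameters, so the step \<open>g\<close> is read in an environment with these two entries
  prepended.\<close>

lemma recursive_rec_nat:
  assumes f: "recursive f" and g: "recursive (\<lambda>e. g (e 0) (e 1) (\<lambda>i. e (Suc (Suc i))))"
    and a: "recursive a"
  shows "recursive (\<lambda>e. rec_nat (f e) (\<lambda>m y. g m y e) (a e))"
proof -
  let ?G = "\<lambda>e. g (e 0) (e 1) (\<lambda>i. e (Suc (Suc i)))"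
  obtain k1 where k1: "\<And>l. l \<ge> k1 \<Longrightarrow> \<exists>p. \<forall>e. evaluates p (map e [0..<l]) (f e)"
    using recursive_eventually[OF f] by blast
  obtain k2 where k2: "\<And>l. l \<ge> k2 \<Longrightarrow> \<exists>p. \<forall>e. evaluates p (map e [0..<l]) (?G e)"
    using recursive_eventually[OF g] by blast
  define k where "k = max k1 k2"
  have "k1 \<le> k" "k2 \<le> Suc (Suc k)"
    unfolding k_def by auto
  obtain p where p: "\<And>e. evaluates p (map e [0..<k]) (f e)"
    using k1[OF \<open>k1 \<le> k\<close>] by blast
  obtain q where q: "\<And>e. evaluates q (map e [0..<Suc (Suc k)]) (?G e)"
    using k2[OF \<open>k2 \<le> Suc (Suc k)\<close>] by blast
  have q': "evaluates q (m # y # map e [0..<k]) (g m y e)" for m y e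
    using q[of "\<lambda>i. case i of 0 \<Rightarrow> m | Suc 0 \<Rightarrow> y | Suc (Suc j) \<Rightarrow> e j"]
    by (simp add: map_upt_Suc_env del: upt_Suc)
  have pr: "evaluates (PrimRec p q) (n # map e [0..<k]) (rec_nat (f e) (\<lambda>m y. g m y e) n)" for n e
    by (induction n) (auto intro: evaluates.PrimRec_0 evaluates.PrimRec_Suc p q')
  \<comment> \<open>\<open>PrimRec\<close> expects the number of iterations as its first argument.
    It is put at index 0 here and replaced by \<open>a\<close> at the end, which also undoes the
    shift.\<close>
  let ?h = "\<lambda>e. rec_nat (f (\<lambda>i. e (Suc i))) (\<lambda>m y. g m y (\<lambda>i. e (Suc i))) (e 0)"
  have "evaluates (PrimRec p q) (map e [0..<Suc k]) (?h e)" for e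
    unfolding map_upt_Suc_env by (rule pr)
  then have h: "recursive ?h" unfolding recursive_def by blast
  have "recursive (case i of 0 \<Rightarrow> a | Suc j \<Rightarrow> (\<lambda>e. e j))" for i
    by (cases i) (auto intro: a recursive_var)
  from recursive_subst[of ?h "\<lambda>i. case i of 0 \<Rightarrow> a | Suc j \<Rightarrow> (\<lambda>e. e j)", OF h this]
  show ?thesis by simp
qed

section \<open>Arithmetic\<close>

lemma recursive_add: "recursive f \<Longrightarrow> recursive g \<Longrightarrow> recursive (\<lambda>e. f e + g e)"
proof (rule recursive_subst2[of "(+)"])
  have "recursive (\<lambda>e. rec_nat (e 0) (\<lambda>m y. Suc y) (e 1))"
    by (intro recursive_rec_nat recursive_Suc recursive_var)
  moreover have "rec_nat a (\<lambda>m y. Suc y) b = a + b" for a b :: nat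
    by (induction b) auto
  ultimately show "recursive (\<lambda>e. e 0 + e 1)" by simp
qed assumption+

lemma recursive_mult: "recursive f \<Longrightarrow> recursive g \<Longrightarrow> recursive (\<lambda>e. f e * g e)"
proof (rule recursive_subst2[of "(*)"])
  have "recursive (\<lambda>e. rec_nat 0 (\<lambda>m y. y + e 0) (e 1))"
    by (intro recursive_rec_nat recursive_add recursive_var recursive_const)
  moreover have "rec_nat 0 (\<lambda>m y. y + a) b = a * b" for a b :: nat
    by (induction b) auto
  ultimately show "recursive (\<lambda>e. e 0 * e 1)" by simp
qed assumption+

lemma recursive_diff: "recursive f \<Longrightarrow> recursive g \<Longrightarrow> recursive (\<lambda>e. f e - g e)"
proof (rule recursive_subst2[of "(-)"])
  have "recursive (\<lambda>e. rec_nat 0 (\<lambda>m y. m) (e 0))"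
    by (intro recursive_rec_nat recursive_var recursive_const)
  \<comment> \<open>The inner recursion is the predecessor function, which the outer one
    iterates.\<close>
  then have "recursive (\<lambda>e. rec_nat (e 0) (\<lambda>m y. rec_nat 0 (\<lambda>m y. m) y) (e 1))"
    by (intro recursive_rec_nat recursive_var recursive_const)
  moreover have "rec_nat a (\<lambda>m y. rec_nat 0 (\<lambda>m y. m) y) b = a - b" for a b :: nat
  proof -
    have "rec_nat 0 (\<lambda>m y. m) y = y - 1" for y :: nat
      by (cases y) auto
    then show ?thesis by (induction b) auto
  qed
  ultimately show "recursive (\<lambda>e. e 0 - e 1)" by simp
qed assumption+

section \<open>Predicates, case distinction and bounded quantifiers\<close>

lemma recursive_predI:
  assumes "recursive f" and "\<And>e. f e = (if P e then 1 else 0)"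
  shows "recursive_pred P"
proof -
  have "f = (\<lambda>e. if P e then 1 else 0)"
    using assms(2) by (rule ext)
  with assms(1) show ?thesis by (simp only: recursive_pred_def)
qed

lemma recursive_pred_less:
  "recursive f \<Longrightarrow> recursive g \<Longrightarrow> recursive_pred (\<lambda>e. f e < g e)"
  \<comment> \<open>With truncated subtraction this is the sign of \<open>g e - f e\<close>.\<close>
  by (rule recursive_predI[of "\<lambda>e. 1 - (1 - (g e - f e))"])
    (auto intro!: recursive_diff recursive_const)

lemma recursive_pred_not: "recursive_pred P \<Longrightarrow> recursive_pred (\<lambda>e. \<not> P e)"
  by (rule recursive_predI[of "\<lambda>e. 1 - (if P e then 1 else 0)"])
    (auto intro!: recursive_diff recursive_const simp: recursive_pred_def)

lemma recursive_pred_conj: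
  "recursive_pred P \<Longrightarrow> recursive_pred Q \<Longrightarrow> recursive_pred (\<lambda>e. P e \<and> Q e)"
  by (rule recursive_predI[of "\<lambda>e. (if P e then 1 else 0) * (if Q e then 1 else 0)"])
    (auto intro!: recursive_mult simp: recursive_pred_def)

lemma recursive_pred_disj:
  "recursive_pred P \<Longrightarrow> recursive_pred Q \<Longrightarrow> recursive_pred (\<lambda>e. P e \<or> Q e)"
  using recursive_pred_not[OF recursive_pred_conj[OF recursive_pred_not recursive_pred_not], of P Q]
  by simp

lemma recursive_pred_imp:
  "recursive_pred P \<Longrightarrow> recursive_pred Q \<Longrightarrow> recursive_pred (\<lambda>e. P e \<longrightarrow> Q e)"
  unfolding imp_conv_disj by (intro recursive_pred_disj recursive_pred_not)

lemma recursive_pred_le: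
  "recursive f \<Longrightarrow> recursive g \<Longrightarrow> recursive_pred (\<lambda>e. f e \<le> g e)"
  unfolding not_less[symmetric] by (intro recursive_pred_not recursive_pred_less)

lemma recursive_pred_eq:
  "recursive f \<Longrightarrow> recursive g \<Longrightarrow> recursive_pred (\<lambda>e. f e = g e)"
  unfolding eq_iff by (intro recursive_pred_conj recursive_pred_le)

lemma recursive_if:
  assumes "recursive_pred P" "recursive f" "recursive g"
  shows "recursive (\<lambda>e. if P e then f e else g e)"
proof -
  have "recursive (\<lambda>e. (if P e then 1 else 0) * f e + (1 - (if P e then 1 else 0)) * g e)"
    using assms unfolding recursive_pred_def
    by (intro recursive_add recursive_mult recursive_diff recursive_const)
  moreover have "(\<lambda>e. (if P e then 1 else 0) * f e + (1 - (if P e then 1 else 0)) * g e) =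
      (\<lambda>e. if P e then f e else g e)" by auto
  ultimately show ?thesis by simp
qed

text \<open>A primitive recursion up to the bound keeps the value 1 until some instance fails and is
  0 from then on.\<close>

lemma recursive_pred_all_less:
  assumes b: "recursive b" and P: "recursive_pred (\<lambda>e. P (e 0) (\<lambda>i. e (Suc i)))"
  shows "recursive_pred (\<lambda>e. \<forall>n<b e. P n e)"
proof (rule recursive_predI)
  \<comment> \<open>In the body of the recursion index 0 is the counter and index 1 the previous
    value, so the environment of \<open>P\<close> has to skip index 1.\<close>
  have "recursive_pred (\<lambda>e. P (e 0) (\<lambda>i. e (Suc (Suc i))))"
    using recursive_subst[of _ "\<lambda>i e. e (case i of 0 \<Rightarrow> 0 | Suc j \<Rightarrow> Suc (Suc j))",
        OF P[unfolded recursive_pred_def] recursive_var]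
    by (simp add: recursive_pred_def)
  then show "recursive (\<lambda>e. rec_nat 1 (\<lambda>m y. if P m e then y else 0) (b e))"
    using b by (intro recursive_rec_nat recursive_if recursive_const recursive_var)
  show "rec_nat 1 (\<lambda>m y. if P m e then y else 0) (b e) = (if \<forall>n<b e. P n e then 1 else 0 :: nat)" for e
  proof -
    have "rec_nat 1 (\<lambda>m y. if P m e then y else 0) k = (if \<forall>n<k. P n e then 1 else 0 :: nat)" for k
      by (induction k) (auto simp: less_Suc_eq)
    then show ?thesis .
  qed
qed

lemma recursive_pred_ex_less:
  assumes "recursive b" and "recursive_pred (\<lambda>e. P (e 0) (\<lambda>i. e (Suc i)))"
  shows "recursive_pred (\<lambda>e. \<exists>n<b e. P n e)"
proof -
  have "recursive_pred (\<lambda>e. \<not> (\<forall>n<b e. \<not> P n e))"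
    using assms by (intro recursive_pred_not recursive_pred_all_less)
  then show ?thesis by simp
qed

text \<open>Minimization is applied to the characteristic function with 0 for truth. That function
  is total, and \<open>ex\<close> supplies a zero in every environment, so the search always
  halts.\<close>

lemma recursive_Least:
  assumes P: "recursive_pred (\<lambda>e. P (e 0) (\<lambda>i. e (Suc i)))" and ex: "\<And>e. \<exists>n. P n e"
  shows "recursive (\<lambda>e. LEAST n. P n e)"
proof -
  let ?F = "\<lambda>e. if P (e 0) (\<lambda>i. e (Suc i)) then 0 else 1 :: nat"
  have "recursive ?F"
    using P by (intro recursive_if recursive_const)
  then obtain k where k: "\<And>l. l \<ge> k \<Longrightarrow> \<exists>p. \<forall>e. evaluates p (map e [0..<l]) (?F e)"
    using recursive_eventually by blast
  obtain p where p: "\<And>e. evaluates p (map e [0..<Suc k]) (?F e)"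
    using k[of "Suc k"] by auto
  have p': "evaluates p (n # map e [0..<k]) (if P n e then 0 else 1)" for n e
    using p[of "\<lambda>i. case i of 0 \<Rightarrow> n | Suc j \<Rightarrow> e j"]
    by (simp add: map_upt_Suc_env del: upt_Suc)
  have "evaluates (Mu p) (map e [0..<k]) (LEAST n. P n e)" for e
  proof (rule evaluates.Mu)
    show "evaluates p ((LEAST n. P n e) # map e [0..<k]) 0"
      using p'[of "LEAST n. P n e" e] LeastI_ex[OF ex[of e]] by simp
    show "\<forall>i<LEAST n. P n e. \<exists>y. evaluates p (i # map e [0..<k]) (Suc y)"
      using p' not_less_Least by (metis One_nat_def)
  qed
  then show ?thesis unfolding recursive_def by blast
qed

lemma recursive_computable:
  assumes "computable f" "recursive g"
  shows "recursive (\<lambda>e. f (g e))"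
proof (rule recursive_subst1[of f, OF _ assms(2)])
  obtain p where "\<And>n. evaluates p [n] (f n)"
    using assms(1) unfolding computable_def by blast
  then have "\<And>e. evaluates p (map e [0..<1]) (f (e 0))" by simp
  then show "recursive (\<lambda>e. f (e 0))" unfolding recursive_def by blast
qed

lemma computable_if_recursive:
  assumes "recursive (\<lambda>e. f (e 0))"
  shows "computable f"
proof -
  obtain k p where p: "\<And>e. evaluates p (map e [0..<k]) (f (e 0))"
    using assms unfolding recursive_def by blast
  \<comment> \<open>Only one argument is available; every further entry that \<open>p\<close> reads
    is filled with 0.\<close>
  have "evaluates (Comp p (map (\<lambda>i. if i = 0 then Proj 0 else Zero) [0..<k])) [n] (f n)" for n
  proof (rule evaluates_Comp_map)
    show "evaluates (if i = 0 then Proj 0 else Zero) [n] (if i = 0 then n else 0)" for i :: nat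
      using evaluates.Proj[of 0 "[n]"] evaluates.Zero by simp
    show "evaluates p (map (\<lambda>i. if i = 0 then n else 0) [0..<k]) (f n)"
      using p[of "\<lambda>i. if i = 0 then n else 0"] by simp
  qed
  then show ?thesis unfolding computable_def by blast
qed

lemmas recursive_intros = recursive_var recursive_const recursive_Suc recursive_add recursive_mult
  recursive_diff recursive_rec_nat recursive_if recursive_pred_less recursive_pred_le
  recursive_pred_eq recursive_pred_not recursive_pred_conj recursive_pred_disj recursive_pred_imp
  recursive_pred_all_less recursive_pred_ex_less

section \<open>Coded lists\<close>

text \<open>\<open>list_encode\<close> maps the empty list to 0 and any other list to the successor
  of the pair of its head and its coded tail; hence the subtraction of 1.\<close>

definition code_hd :: "nat \<Rightarrow> nat" where
  "code_hd z = fst (prod_decode (z - 1))"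

definition code_tl :: "nat \<Rightarrow> nat" where
  "code_tl z = (if z = 0 then 0 else snd (prod_decode (z - 1)))"

definition code_nth :: "nat \<Rightarrow> nat \<Rightarrow> nat" where
  "code_nth z i = code_hd ((code_tl ^^ i) z)"

text \<open>Since 0 codes the empty list, the length is the number of tails taken until 0 appears,
  which minimization can find.\<close>

definition code_length :: "nat \<Rightarrow> nat" where
  "code_length z = (LEAST i. (code_tl ^^ i) z = 0)"

lemma funpow_code_tl: "(code_tl ^^ i) (list_encode xs) = list_encode (drop i xs)"
proof (induction i)
  case (Suc i)
  have "code_tl (list_encode ys) = list_encode (tl ys)" for ys
    by (cases ys) (auto simp: code_tl_def)
  with Suc show ?case by (simp add: drop_Suc tl_drop)
qed simp

lemma code_nth_list_encode: "i < length xs \<Longrightarrow> code_nth (list_encode xs) i = xs ! i"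
  by (simp add: code_nth_def funpow_code_tl code_hd_def Cons_nth_drop_Suc[symmetric])

lemma code_length_list_encode: "code_length (list_encode xs) = length xs"
proof -
  have "(list_encode ys = 0) = (ys = [])" for ys
    by (cases ys) auto
  then show ?thesis
    unfolding code_length_def funpow_code_tl by (auto intro!: Least_equality)
qed

text \<open>Every number codes a list because \<open>list_encode\<close> is onto. This rebuilds a
  code from its entries.\<close>

lemma list_encode_code_nth: "list_encode (map (code_nth z) [0..<code_length z]) = z"
proof -
  have "map (code_nth (list_encode xs)) [0..<length xs] = xs" for xs
    by (rule nth_equalityI) (auto simp: code_nth_list_encode)
  from this[of "list_decode z"] show ?thesis
    by (metis code_length_list_encode list_decode_inverse)
qed

section \<open>Recursiveness of pairing and of the list operations\<close>

lemma recursive_prod_encode: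
  "recursive f \<Longrightarrow> recursive g \<Longrightarrow> recursive (\<lambda>e. prod_encode (f e, g e))"
proof (rule recursive_subst2[of "\<lambda>a b. prod_encode (a, b)"])
  have "triangle n = rec_nat 0 (\<lambda>m y. y + Suc m) n" for n
    by (induction n) auto
  then show "recursive (\<lambda>e. prod_encode (e 0, e 1))"
    by (simp only: prod_encode_def prod.case) (intro recursive_intros)
qed assumption+

lemma recursive_prod_decode:
  assumes "recursive f"
  shows "recursive (\<lambda>e. fst (prod_decode (f e)))" "recursive (\<lambda>e. snd (prod_decode (f e)))"
proof -
  have eq: "prod_encode (a, b) = z \<longleftrightarrow> a = fst (prod_decode z) \<and> b = snd (prod_decode z)" for a b z
    by (metis prod.collapse prod_decode_inverse prod_encode_inverse fst_conv snd_conv)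
  \<comment> \<open>Neither component exceeds the code of the pair, so each is found by minimization
    with a bounded search for the other.\<close>
  have le: "fst (prod_decode z) \<le> z" "snd (prod_decode z) \<le> z" for z
    using le_prod_encode_1 le_prod_encode_2 by (metis prod.collapse prod_decode_inverse)+
  have "recursive (\<lambda>e. LEAST a. \<exists>b<Suc (e 0). prod_encode (a, b) = e 0)"
    by (intro recursive_Least recursive_intros recursive_prod_encode)
      (auto simp: eq less_Suc_eq_le le)
  moreover have "(LEAST a. \<exists>b<Suc z. prod_encode (a, b) = z) = fst (prod_decode z)" for z
    by (rule Least_equality) (auto simp: eq less_Suc_eq_le le)
  ultimately have "recursive (\<lambda>e. fst (prod_decode (e 0)))" by simp
  then show "recursive (\<lambda>e. fst (prod_decode (f e)))"
    using assms by (rule recursive_subst1)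
  have "recursive (\<lambda>e. LEAST b. \<exists>a<Suc (e 0). prod_encode (a, b) = e 0)"
    by (intro recursive_Least recursive_intros recursive_prod_encode)
      (auto simp: eq less_Suc_eq_le le)
  moreover have "(LEAST b. \<exists>a<Suc z. prod_encode (a, b) = z) = snd (prod_decode z)" for z
    by (rule Least_equality) (auto simp: eq less_Suc_eq_le le)
  ultimately have "recursive (\<lambda>e. snd (prod_decode (e 0)))" by simp
  then show "recursive (\<lambda>e. snd (prod_decode (f e)))"
    using assms by (rule recursive_subst1)
qed

lemma recursive_funpow_code_tl:
  assumes "recursive f" "recursive g"
  shows "recursive (\<lambda>e. (code_tl ^^ g e) (f e))"
proof -
  have "(code_tl ^^ n) z = rec_nat z (\<lambda>m y. if y = 0 then 0 else snd (prod_decode (y - 1))) n" for n z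
    by (induction n) (auto simp: code_tl_def)
  then show ?thesis
    using assms by simp (intro recursive_intros recursive_prod_decode)
qed

lemma recursive_code_nth:
  "recursive f \<Longrightarrow> recursive g \<Longrightarrow> recursive (\<lambda>e. code_nth (f e) (g e))"
  unfolding code_nth_def code_hd_def
  by (intro recursive_funpow_code_tl recursive_prod_decode recursive_diff recursive_const)

lemma recursive_code_length: "recursive f \<Longrightarrow> recursive (\<lambda>e. code_length (f e))"
proof (rule recursive_subst1[of code_length])
  have "\<exists>n. (code_tl ^^ n) z = 0" for z
  proof -
    have "(code_tl ^^ length (list_decode z)) (list_encode (list_decode z)) = 0"
      by (simp only: funpow_code_tl) simp
    then show ?thesis by auto
  qed
  then show "recursive (\<lambda>e. code_length (e 0))"
    unfolding code_length_def
    by (intro recursive_Least recursive_intros recursive_funpow_code_tl)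
qed assumption+

section \<open>Runs on words containing all factors\<close>

definition run :: "'a dfa \<Rightarrow> 'a word \<Rightarrow> nat \<Rightarrow> nat" where
  "run M W n = foldl (delta M) (init M) (prefix n W)"

lemma run_0: "run M W 0 = init M"
  by (simp add: run_def)

lemma run_add: "run M W (m + n) = foldl (delta M) (run M W m) (W[m \<rightarrow> m + n])"
  by (simp add: run_def subsequence_append)

lemma run_Suc: "run M W (Suc n) = delta M (run M W n) (W n)"
  using run_add[of M W n 1] by simp

lemma foldl_closed:
  assumes "\<And>q a. q \<in> Q \<Longrightarrow> a \<in> \<Sigma> \<Longrightarrow> d q a \<in> Q" "u \<in> lists \<Sigma>" "q \<in> Q"
  shows "foldl d q u \<in> Q"
  using assms(2,3) by (induction u arbitrary: q) (auto intro: assms(1))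

lemma run_closed:
  assumes "\<And>q a. q \<in> Q \<Longrightarrow> a \<in> \<Sigma> \<Longrightarrow> delta M q a \<in> Q" "\<And>n. W n \<in> \<Sigma>"
    and "run M W m \<in> Q" "m \<le> n"
  shows "run M W n \<in> Q"
  using assms(4,3) by (induction n rule: dec_induct) (auto simp: run_Suc intro: assms(1,2))

lemma run_less_nstates:
  assumes "is_dfa \<Sigma> M" "\<And>n. W n \<in> \<Sigma>"
  shows "run M W n < nstates M"
  using run_closed[of "{..<nstates M}" \<Sigma> M W 0 n] assms by (auto simp: is_dfa_def run_0)

text \<open>If \<open>m\<close> letters followed by \<open>u\<close> occur at position
  \<open>i\<close>, then \<open>u\<close> occurs at \<open>i + m\<close>. The letter
  \<open>W 0\<close> serves as padding.\<close>

lemma recurrent_factor: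
  assumes "\<And>n. W n \<in> \<Sigma>" "\<And>u. u \<in> lists \<Sigma> \<Longrightarrow> factor u W" "u \<in> lists \<Sigma>"
  shows "\<exists>i\<ge>m. W[i \<rightarrow> i + length u] = u"
proof (cases "u = []")
  case False
  have "replicate m (W 0) @ u \<in> lists \<Sigma>"
    using assms by auto
  then obtain i j where ij: "replicate m (W 0) @ u = W[i \<rightarrow> j]"
    using assms(2) unfolding factor_def by blast
  \<comment> \<open>The factor is empty when \<open>j < i\<close>; as \<open>u\<close> is nonempty,
    this is excluded and the lengths determine \<open>j\<close>.\<close>
  from arg_cong[OF ij, of length] False have "j = i + m + length u"
    by (cases "i \<le> j") auto
  with arg_cong[OF ij, of "drop m"] have "W[i + m \<rightarrow> i + m + length u] = u"
    by (simp add: add.commute)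
  then show ?thesis
    by (intro exI[of _ "i + m"]) simp
qed auto

text \<open>States are handled one at a time: the word found so far leads the new state somewhere
  into \<open>Q\<close>, and \<open>hit\<close> continues it from there. The continuation moves the
  earlier states on, which is why only a hit after some prefix is claimed.\<close>

lemma common_hitting_word:
  assumes "finite S" "S \<subseteq> Q" and closed: "\<And>q a. q \<in> Q \<Longrightarrow> a \<in> \<Sigma> \<Longrightarrow> d q a \<in> Q"
    and hit: "\<And>q. q \<in> Q \<Longrightarrow> \<exists>u\<in>lists \<Sigma>. P (foldl d q u)"
  shows "\<exists>u\<in>lists \<Sigma>. \<forall>q\<in>S. \<exists>n\<le>length u. P (foldl d q (take n u))"
  using assms(1,2)
proof (induction S rule: finite_induct)
  case (insert q S)
  then obtain u where u: "u \<in> lists \<Sigma>" "\<And>q. q \<in> S \<Longrightarrow> \<exists>n\<le>length u. P (foldl d q (take n u))"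
    by auto
  have "foldl d q u \<in> Q"
    using foldl_closed[OF closed u(1)] insert.prems by auto
  then obtain v where v: "v \<in> lists \<Sigma>" "P (foldl d (foldl d q u) v)"
    using hit by blast
  have "\<exists>n\<le>length (u @ v). P (foldl d p (take n (u @ v)))" if "p \<in> insert q S" for p
  proof (cases "p = q")
    case True
    with v show ?thesis by (intro exI[of _ "length (u @ v)"]) simp
  next
    case False
    with that u(2) obtain n where "n \<le> length u" "P (foldl d p (take n u))"
      by blast
    then show ?thesis by (intro exI[of _ n]) simp
  qed
  moreover have "u @ v \<in> lists \<Sigma>"
    using u(1) v(1) by simp
  ultimately show ?case by blast
qed auto

text \<open>By \<open>common_hitting_word\<close> one word serves all states of \<open>Q\<close>,
  and by \<open>recurrent_factor\<close> it occurs at some position not before \<open>m\<close>. The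
  run is still in \<open>Q\<close> there, so it meets \<open>P\<close> along this
  occurrence.\<close>

lemma run_hits:
  assumes "\<And>n. W n \<in> \<Sigma>" "\<And>u. u \<in> lists \<Sigma> \<Longrightarrow> factor u W"
    and "finite Q" and closed: "\<And>q a. q \<in> Q \<Longrightarrow> a \<in> \<Sigma> \<Longrightarrow> delta M q a \<in> Q"
    and hit: "\<And>q. q \<in> Q \<Longrightarrow> \<exists>u\<in>lists \<Sigma>. P (foldl (delta M) q u)"
    and "run M W m \<in> Q"
  shows "\<exists>n\<ge>m. P (run M W n)"
proof -
  obtain u where u: "u \<in> lists \<Sigma>"
    "\<And>q. q \<in> Q \<Longrightarrow> \<exists>n\<le>length u. P (foldl (delta M) q (take n u))"
    using common_hitting_word[OF \<open>finite Q\<close> subset_refl closed hit] by blast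
  obtain i where i: "i \<ge> m" "W[i \<rightarrow> i + length u] = u"
    using recurrent_factor[OF assms(1,2) u(1)] by blast
  have "run M W i \<in> Q"
    using run_closed[of Q \<Sigma> M W m i] closed assms(1,6) i(1) by blast
  then obtain n where n: "n \<le> length u" "P (foldl (delta M) (run M W i) (take n u))"
    using u(2) by blast
  have "take n u = W[i \<rightarrow> i + n]"
    using n(1) by (subst i(2)[symmetric]) (simp add: min_def)
  with n(2) have "P (run M W (i + n))"
    by (simp add: run_add)
  with i(1) show ?thesis
    by (intro exI[of _ "i + n"]) simp
qed

text \<open>Prefixes are told apart by their lengths, so the accepted prefixes correspond one-to-one
  to the times at which the run is in a final state.\<close>

lemma buchi_realizable_lang_iff:
  assumes "\<And>n. W n \<in> \<Sigma>"
  shows "buchi_realizable W (lang \<Sigma> M) \<longleftrightarrow> (\<forall>m. \<exists>n\<ge>m. run M W n \<in> final M)"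
proof -
  have "lang \<Sigma> M \<inter> Pref W = (\<lambda>n. prefix n W) ` {n. run M W n \<in> final M}"
    using assms by (auto simp: lang_def Pref_def run_def)
  moreover have "inj_on (\<lambda>n. prefix n W) A" for A
    by (rule inj_onI) (metis subsequence_length diff_zero)
  ultimately show ?thesis
    by (simp add: buchi_realizable_def finite_image_iff infinite_nat_iff_unbounded_le)
qed

section \<open>Certificates\<close>

text \<open>The support of \<open>r\<close> stands for the set of states reachable from \<open>q\<close>. In the accepting case
  the values bound the distance to a final state.\<close>

definition accepting_ranking :: "'a set \<Rightarrow> 'a dfa \<Rightarrow> nat \<Rightarrow> (nat \<Rightarrow> nat) \<Rightarrow> bool" where
  "accepting_ranking \<Sigma> M q r \<longleftrightarrow> 0 < r q \<and> (\<forall>p<nstates M. 0 < r p \<longrightarrow>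
     (\<forall>a\<in>\<Sigma>. 0 < r (delta M p a)) \<and> (p \<in> final M \<or> (\<exists>a\<in>\<Sigma>. r (delta M p a) < r p)))"

definition rejecting_ranking :: "'a set \<Rightarrow> 'a dfa \<Rightarrow> nat \<Rightarrow> (nat \<Rightarrow> nat) \<Rightarrow> bool" where
  "rejecting_ranking \<Sigma> M q r \<longleftrightarrow> 0 < r q \<and> (\<forall>p<nstates M. 0 < r p \<longrightarrow>
     (\<forall>a\<in>\<Sigma>. 0 < r (delta M p a)) \<and> p \<notin> final M)"

definition reaches :: "'a set \<Rightarrow> 'a dfa \<Rightarrow> (nat \<Rightarrow> bool) \<Rightarrow> nat \<Rightarrow> bool" where
  "reaches \<Sigma> M P q \<longleftrightarrow> (\<exists>u\<in>lists \<Sigma>. P (foldl (delta M) q u))"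

lemma reaches_refl: "P q \<Longrightarrow> reaches \<Sigma> M P q"
  unfolding reaches_def by (rule bexI[of _ "[]"]) auto

lemma reaches_step: "a \<in> \<Sigma> \<Longrightarrow> reaches \<Sigma> M P (delta M q a) \<Longrightarrow> reaches \<Sigma> M P q"
  unfolding reaches_def by (metis foldl_Cons lists.Cons)

text \<open>The support of \<open>r\<close> is closed under transitions, and following letters that
  lower the rank must end in a final state. So \<open>run_hits\<close> applies to the support,
  starting from a time at or after both \<open>l\<close> and \<open>m\<close>.\<close>

lemma accepting_ranking_sound:
  assumes W: "\<And>n. W n \<in> \<Sigma>" "\<And>u. u \<in> lists \<Sigma> \<Longrightarrow> factor u W"
    and M: "is_dfa \<Sigma> M" and r: "accepting_ranking \<Sigma> M (run M W m) r"
  shows "\<exists>n\<ge>l. run M W n \<in> final M"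
proof -
  let ?Q = "{q. q < nstates M \<and> 0 < r q}"
  have closed: "delta M q a \<in> ?Q" if "q \<in> ?Q" "a \<in> \<Sigma>" for q a
    using M r that by (auto simp: is_dfa_def accepting_ranking_def)
  have "reaches \<Sigma> M (\<lambda>q. q \<in> final M) q" if "q \<in> ?Q" for q
    using that
  proof (induction q rule: measure_induct_rule[of r])
    case (less q)
    then consider "q \<in> final M" | a where "a \<in> \<Sigma>" "r (delta M q a) < r q"
      using r by (auto simp: accepting_ranking_def)
    then show ?case
    proof cases
      case 2
      with less closed show ?thesis by (blast intro: reaches_step)
    qed (rule reaches_refl)
  qed
  then have hit: "\<exists>u\<in>lists \<Sigma>. foldl (delta M) q u \<in> final M" if "q \<in> ?Q" for q
    using that unfolding reaches_def by blast
  have "run M W m \<in> ?Q"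
    using r run_less_nstates[OF M W(1)] by (simp add: accepting_ranking_def)
  then have "run M W (max l m) \<in> ?Q"
    using run_closed[of ?Q \<Sigma> M W m "max l m"] closed W(1) by simp
  from run_hits[OF W _ closed hit this] show ?thesis by auto
qed

text \<open>The support of \<open>r\<close> is closed under transitions and contains no final state,
  so the run is trapped there.\<close>

lemma rejecting_ranking_sound:
  assumes W: "\<And>n. W n \<in> \<Sigma>" and M: "is_dfa \<Sigma> M"
    and r: "rejecting_ranking \<Sigma> M (run M W m) r" and "m \<le> n"
  shows "run M W n \<notin> final M"
proof -
  let ?Q = "{q. q < nstates M \<and> 0 < r q}"
  have "delta M q a \<in> ?Q" if "q \<in> ?Q" "a \<in> \<Sigma>" for q a
    using M r that by (auto simp: is_dfa_def rejecting_ranking_def)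
  moreover have "run M W m \<in> ?Q"
    using r run_less_nstates[OF M W(1)] by (simp add: rejecting_ranking_def)
  ultimately have "run M W n \<in> ?Q"
    using run_closed[of ?Q \<Sigma> M W m n] W \<open>m \<le> n\<close> by blast
  then show ?thesis
    using r by (auto simp: rejecting_ranking_def)
qed

section \<open>Existence of certificates\<close>

lemma not_reaches_step: "\<not> reaches \<Sigma> M P q \<Longrightarrow> a \<in> \<Sigma> \<Longrightarrow> \<not> reaches \<Sigma> M P (delta M q a)"
  by (blast intro: reaches_step)

lemma rejecting_ranking_exists:
  assumes "\<not> reaches \<Sigma> M (\<lambda>q. q \<in> final M) q"
  shows "\<exists>r. rejecting_ranking \<Sigma> M q r"
  using assms
  by (intro exI[of _ "\<lambda>q. if reaches \<Sigma> M (\<lambda>q. q \<in> final M) q then 0 else 1"])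
    (auto simp: rejecting_ranking_def not_reaches_step reaches_refl)

lemma accepting_ranking_exists:
  assumes "\<not> reaches \<Sigma> M (\<lambda>q. \<not> reaches \<Sigma> M (\<lambda>q. q \<in> final M) q) q"
  shows "\<exists>r. accepting_ranking \<Sigma> M q r"
proof -
  let ?dead = "\<lambda>q. \<not> reaches \<Sigma> M (\<lambda>q. q \<in> final M) q"
  let ?B = "reaches \<Sigma> M ?dead"
  \<comment> \<open>The distance to a nearest final state, meaningful for states that are not
    dead.\<close>
  define D where "D q = (LEAST n. \<exists>u\<in>lists \<Sigma>. length u = n \<and> foldl (delta M) q u \<in> final M)" for q
  have "p \<in> final M \<or> (\<exists>a\<in>\<Sigma>. D (delta M p a) < D p)" if p: "\<not> ?B p" for p
  proof -
    have "reaches \<Sigma> M (\<lambda>q. q \<in> final M) p"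
      using p reaches_refl[of ?dead p \<Sigma> M] by argo
    then have "\<exists>n. \<exists>u\<in>lists \<Sigma>. length u = n \<and> foldl (delta M) p u \<in> final M"
      unfolding reaches_def by blast
    from LeastI_ex[OF this] obtain u
      where u: "u \<in> lists \<Sigma>" "length u = D p" "foldl (delta M) p u \<in> final M"
      unfolding D_def[symmetric] by blast
    \<comment> \<open>The first letter of a shortest word to a final state lowers \<open>D\<close>;
      if that word is empty, \<open>p\<close> itself is final.\<close>
    show ?thesis
    proof (cases u)
      case (Cons a v)
      with u have "D (delta M p a) \<le> length v"
        unfolding D_def by (intro Least_le bexI[of _ v]) auto
      with u Cons have "a \<in> \<Sigma>" "D (delta M p a) < D p" by auto
      then show ?thesis by blast
    qed (use u in simp)
  qed
  moreover have "\<not> ?B (delta M p a)" if "\<not> ?B p" "a \<in> \<Sigma>" for p a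
    using that by (rule not_reaches_step)
  \<comment> \<open>The value 0 marks states outside the support, so \<open>Suc\<close> is needed to
    keep final states, where \<open>D\<close> is 0, inside it.\<close>
  ultimately have "accepting_ranking \<Sigma> M q (\<lambda>q. if ?B q then 0 else Suc (D q))"
    using assms unfolding accepting_ranking_def by simp
  then show ?thesis by blast
qed

text \<open>A state that can reach a dead state is led to one by some word; for any other state the
  empty word suffices. Hence \<open>run_hits\<close> with the set of all states brings the run to a
  state that has a certificate.\<close>

lemma ranking_exists:
  assumes W: "\<And>n. W n \<in> \<Sigma>" "\<And>u. u \<in> lists \<Sigma> \<Longrightarrow> factor u W" and M: "is_dfa \<Sigma> M"
  shows "\<exists>n r. accepting_ranking \<Sigma> M (run M W n) r \<or> rejecting_ranking \<Sigma> M (run M W n) r"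
proof -
  let ?dead = "\<lambda>q. \<not> reaches \<Sigma> M (\<lambda>q. q \<in> final M) q"
  let ?P = "\<lambda>q. ?dead q \<or> \<not> reaches \<Sigma> M ?dead q"
  have "\<exists>u\<in>lists \<Sigma>. ?P (foldl (delta M) q u)" for q
  proof (cases "reaches \<Sigma> M ?dead q")
    case True
    then obtain u where "u \<in> lists \<Sigma>" "?dead (foldl (delta M) q u)"
      unfolding reaches_def[of _ _ ?dead] by blast
    then show ?thesis by blast
  next
    case False
    then show ?thesis by (intro bexI[of _ "[]"]) auto
  qed
  moreover have "delta M q a \<in> {..<nstates M}" if "q \<in> {..<nstates M}" "a \<in> \<Sigma>" for q a
    using M that by (simp add: is_dfa_def)
  ultimately have "\<exists>n\<ge>0. ?P (run M W n)"
    using run_less_nstates[OF M W(1)]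
    by (intro run_hits[OF W, where Q = "{..<nstates M}" and P = ?P]) auto
  then show ?thesis
    using rejecting_ranking_exists accepting_ranking_exists by blast
qed

text \<open>Only the values on the finitely many states matter, so a ranking may be replaced by a
  coded list.\<close>

lemma ranking_cong:
  assumes M: "is_dfa \<Sigma> M" and "q < nstates M" and eq: "\<And>p. p < nstates M \<Longrightarrow> r p = r' p"
  shows "accepting_ranking \<Sigma> M q r \<longleftrightarrow> accepting_ranking \<Sigma> M q r'"
    and "rejecting_ranking \<Sigma> M q r \<longleftrightarrow> rejecting_ranking \<Sigma> M q r'"
proof -
  have "r (delta M p a) = r' (delta M p a)" if "p < nstates M" "a \<in> \<Sigma>" for p a
    using M eq that by (auto simp: is_dfa_def)
  then show "accepting_ranking \<Sigma> M q r \<longleftrightarrow> accepting_ranking \<Sigma> M q r'"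
    and "rejecting_ranking \<Sigma> M q r \<longleftrightarrow> rejecting_ranking \<Sigma> M q r'"
    using assms(2) eq by (auto simp: accepting_ranking_def rejecting_ranking_def)
qed

section \<open>Coded automata\<close>

definition code_step :: "nat \<Rightarrow> nat \<Rightarrow> nat \<Rightarrow> nat" where
  "code_step x q a = code_nth (code_nth (code_nth x 2) q) a"

definition code_run :: "(nat \<Rightarrow> nat) \<Rightarrow> nat \<Rightarrow> nat \<Rightarrow> nat" where
  "code_run f x n = rec_nat (code_nth x 1) (\<lambda>m q. code_step x q (f m)) n"

text \<open>The conditions on the lengths and the bound 1 on the entries of the last list make this
  describe the codes exactly, so that a program can reject every other number.\<close>

definition is_code :: "nat \<Rightarrow> nat \<Rightarrow> bool" where
  "is_code k x \<longleftrightarrow> code_length x = 4 \<and> code_nth x 1 < code_nth x 0 \<and>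
     code_length (code_nth x 2) = code_nth x 0 \<and> code_length (code_nth x 3) = code_nth x 0 \<and>
     (\<forall>q<code_nth x 0. code_length (code_nth (code_nth x 2) q) = k \<and>
        (\<forall>a<k. code_step x q a < code_nth x 0) \<and> code_nth (code_nth x 3) q \<le> 1)"

definition code_accepting :: "nat \<Rightarrow> nat \<Rightarrow> nat \<Rightarrow> nat \<Rightarrow> bool" where
  "code_accepting k x q c \<longleftrightarrow> 0 < code_nth c q \<and> (\<forall>p<code_nth x 0. 0 < code_nth c p \<longrightarrow>
     (\<forall>a<k. 0 < code_nth c (code_step x p a)) \<and>
     (code_nth (code_nth x 3) p = 1 \<or> (\<exists>a<k. code_nth c (code_step x p a) < code_nth c p)))"

definition code_rejecting :: "nat \<Rightarrow> nat \<Rightarrow> nat \<Rightarrow> nat \<Rightarrow> bool" where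
  "code_rejecting k x q c \<longleftrightarrow> 0 < code_nth c q \<and> (\<forall>p<code_nth x 0. 0 < code_nth c p \<longrightarrow>
     (\<forall>a<k. 0 < code_nth c (code_step x p a)) \<and> code_nth (code_nth x 3) p \<noteq> 1)"

lemma code_nth_dfa_code:
  "code_nth (dfa_code as M) 0 = nstates M"
  "code_nth (dfa_code as M) (Suc 0) = init M"
  "q < nstates M \<Longrightarrow> code_nth (code_nth (dfa_code as M) 3) q = Suc 0 \<longleftrightarrow> q \<in> final M"
  "q < nstates M \<Longrightarrow> code_nth (code_nth (dfa_code as M) 3) q \<le> Suc 0"
  "q < nstates M \<Longrightarrow> i < length as \<Longrightarrow> code_step (dfa_code as M) q i = delta M q (as ! i)"
  unfolding dfa_code_def code_step_def by (simp_all add: code_nth_list_encode del: list_encode.simps)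

lemma code_run_dfa_code:
  assumes M: "is_dfa (set as) M" and f: "\<And>n. f n < length as" "\<And>n. W n = as ! f n"
  shows "code_run f (dfa_code as M) n = run M W n"
proof -
  have "\<And>n. W n \<in> set as"
    using f by simp
  then have less: "run M W n < nstates M" for n
    by (rule run_less_nstates[OF M])
  have "code_step (dfa_code as M) (run M W n) (f n) = delta M (run M W n) (W n)" for n
    using code_nth_dfa_code(5)[where as = as, OF less f(1), of n n] f(2)[of n] by simp
  then show ?thesis
    by (induction n) (simp_all add: code_run_def run_0 run_Suc code_nth_dfa_code)
qed

lemma ball_set_nth: "(\<forall>a\<in>set xs. P a) \<longleftrightarrow> (\<forall>i<length xs. P (xs ! i))"
  by (simp add: all_set_conv_all_nth)

lemma bex_set_nth: "(\<exists>a\<in>set xs. P a) \<longleftrightarrow> (\<exists>i<length xs. P (xs ! i))"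
  by (metis in_set_conv_nth)

lemma code_accepting_dfa_code:
  "code_accepting (length as) (dfa_code as M) q c \<longleftrightarrow> accepting_ranking (set as) M q (code_nth c)"
  by (simp add: code_accepting_def accepting_ranking_def code_nth_dfa_code ball_set_nth bex_set_nth
      cong: conj_cong)

lemma code_rejecting_dfa_code:
  "code_rejecting (length as) (dfa_code as M) q c \<longleftrightarrow> rejecting_ranking (set as) M q (code_nth c)"
  by (simp add: code_rejecting_def rejecting_ranking_def code_nth_dfa_code ball_set_nth)

lemma is_code_dfa_code:
  assumes "is_dfa (set as) M"
  shows "is_code (length as) (dfa_code as M)"
proof -
  have "code_length (dfa_code as M) = 4"
    "code_length (code_nth (dfa_code as M) 2) = nstates M"
    "code_length (code_nth (dfa_code as M) 3) = nstates M"
    "\<And>q. q < nstates M \<Longrightarrow> code_length (code_nth (code_nth (dfa_code as M) 2) q) = length as"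
    unfolding dfa_code_def by (simp_all add: code_nth_list_encode code_length_list_encode del: list_encode.simps)
  with assms show ?thesis
    by (simp add: is_code_def code_nth_dfa_code is_dfa_def)
qed

lemma dfa_of_code:
  assumes "distinct as" and x: "is_code (length as) x"
  shows "\<exists>M. is_dfa (set as) M \<and> x = dfa_code as M"
proof -
  \<comment> \<open>As \<open>as\<close> is distinct, a letter in it has a unique position, and the
    table is read there.\<close>
  define M :: "'a dfa" where "M = \<lparr>nstates = code_nth x 0, init = code_nth x 1,
     delta = (\<lambda>q a. code_step x q (THE i. i < length as \<and> as ! i = a)),
     final = {q. q < code_nth x 0 \<and> code_nth (code_nth x 3) q = 1}\<rparr>"
  have sel: "nstates M = code_nth x 0" "init M = code_nth x 1"
    "final M = {q. q < code_nth x 0 \<and> code_nth (code_nth x 3) q = 1}"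
    unfolding M_def by simp_all
  have delta: "delta M q (as ! i) = code_step x q i" if "i < length as" for q i
  proof -
    have "(THE j. j < length as \<and> as ! j = as ! i) = i"
      using that assms(1) by (intro the_equality) (auto simp: nth_eq_iff_index_eq)
    then show ?thesis by (simp add: M_def)
  qed
  have M: "is_dfa (set as) M"
    using x unfolding is_dfa_def ball_set_nth by (auto simp: is_code_def sel delta)
  have row: "map (delta M q) as = map (code_step x q) [0..<length as]" for q
    by (rule nth_equalityI) (auto simp: delta)
  have "list_encode (map (delta M q) as) = code_nth (code_nth x 2) q" if "q < code_nth x 0" for q
    using list_encode_code_nth[of "code_nth (code_nth x 2) q"] x that
    unfolding row by (simp add: is_code_def code_step_def[abs_def])
  then have rows: "map (\<lambda>q. list_encode (map (delta M q) as)) [0..<nstates M] =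
      map (code_nth (code_nth x 2)) [0..<nstates M]"
    by (simp add: sel)
  have fin: "(if q \<in> final M then 1 else 0) = code_nth (code_nth x 3) q" if "q < code_nth x 0" for q
  proof -
    have "code_nth (code_nth x 3) q \<le> 1"
      using x that unfolding is_code_def by blast
    then show ?thesis
      using that unfolding sel by (cases "code_nth (code_nth x 3) q") auto
  qed
  have fins: "map (\<lambda>q. if q \<in> final M then 1 else 0) [0..<nstates M] =
      map (code_nth (code_nth x 3)) [0..<nstates M]"
    by (rule map_cong[OF refl], rule fin) (simp add: sel(1))
  have len: "code_length (code_nth x 2) = nstates M" "code_length (code_nth x 3) = nstates M"
    using x unfolding is_code_def sel(1) by blast+
  have T: "list_encode (map (\<lambda>q. list_encode (map (delta M q) as)) [0..<nstates M]) = code_nth x 2"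
    unfolding rows using list_encode_code_nth[of "code_nth x 2"] unfolding len .
  have F: "list_encode (map (\<lambda>q. if q \<in> final M then 1 else 0) [0..<nstates M]) = code_nth x 3"
    unfolding fins using list_encode_code_nth[of "code_nth x 3"] unfolding len .
  have "[0..<4] = [0, 1, 2, 3]"
    by (simp add: numeral_eq_Suc)
  then have "x = list_encode [code_nth x 0, code_nth x 1, code_nth x 2, code_nth x 3]"
    using list_encode_code_nth[of x] x by (simp add: is_code_def del: list_encode.simps)
  then have "x = dfa_code as M"
    unfolding dfa_code_def T F unfolding sel(1,2) .
  with M show ?thesis by blast
qed

section \<open>Recursiveness of the operations on coded automata\<close>

lemma recursive_code_step:
  "recursive f \<Longrightarrow> recursive g \<Longrightarrow> recursive h \<Longrightarrow> recursive (\<lambda>e. code_step (f e) (g e) (h e))"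
  unfolding code_step_def by (intro recursive_code_nth recursive_const)

lemma recursive_code_run:
  assumes "computable f" "recursive g" "recursive h"
  shows "recursive (\<lambda>e. code_run f (g e) (h e))"
proof (rule recursive_subst2[of "code_run f", OF _ assms(2,3)])
  show "recursive (\<lambda>e. code_run f (e 0) (e 1))"
    unfolding code_run_def
    by (intro recursive_intros recursive_code_step recursive_code_nth recursive_computable[OF assms(1)])
qed

lemma recursive_is_code: "recursive_pred (\<lambda>e. is_code k (e i))"
  unfolding is_code_def
  by (intro recursive_intros recursive_code_nth recursive_code_length recursive_code_step)

lemma recursive_code_accepting:
  assumes "computable f"
  shows "recursive_pred (\<lambda>e. code_accepting k (e i) (code_run f (e i) (e j)) (e l))"
  unfolding code_accepting_def
  by (intro recursive_intros recursive_code_nth recursive_code_step recursive_code_run assms)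

lemma recursive_code_rejecting:
  assumes "computable f"
  shows "recursive_pred (\<lambda>e. code_rejecting k (e i) (code_run f (e i) (e j)) (e l))"
  unfolding code_rejecting_def
  by (intro recursive_intros recursive_code_nth recursive_code_step recursive_code_run assms)

theorem theorem3:
  fixes \<Sigma> :: "'a set" and as :: "'a list" and W :: "'a word"
  assumes "finite \<Sigma>"
    and "distinct as" and "set as = \<Sigma>"
    and "\<forall>n. W n \<in> \<Sigma>"
    and "computable_word as W"
    and "\<forall>u\<in>lists \<Sigma>. factor u W"
  shows "decidable (buchi_realizability_problem as W)"
proof -
  obtain f where f: "computable f" "\<And>n. f n < length as" "\<And>n. W n = as ! f n"
    using assms(5) unfolding computable_word_def by blast
  have W: "\<And>n. W n \<in> set as" "\<And>u. u \<in> lists (set as) \<Longrightarrow> factor u W"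
    using assms by auto
  define acc where "acc x n c \<longleftrightarrow> code_accepting (length as) x (code_run f x n) c" for x n c
  define rej where "rej x n c \<longleftrightarrow> code_rejecting (length as) x (code_run f x n) c" for x n c
  \<comment> \<open>A single bound limits both the time and the certificate. If \<open>x\<close> is
    not a code the implication is vacuous and the bound is 0, so the search halts on every
    input.\<close>
  define bound where
    "bound x = (LEAST b. is_code (length as) x \<longrightarrow> (\<exists>n<b. \<exists>c<b. acc x n c \<or> rej x n c))" for x
  have acc: "acc (dfa_code as M) n c \<longleftrightarrow> accepting_ranking (set as) M (run M W n) (code_nth c)"
    and rej: "rej (dfa_code as M) n c \<longleftrightarrow> rejecting_ranking (set as) M (run M W n) (code_nth c)"
    if "is_dfa (set as) M" for M n c
    using code_run_dfa_code[OF that f(2,3)]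
    by (simp_all add: acc_def rej_def code_accepting_dfa_code code_rejecting_dfa_code)
  have total: "\<exists>b. is_code (length as) x \<longrightarrow> (\<exists>n<b. \<exists>c<b. acc x n c \<or> rej x n c)" for x
  proof (cases "is_code (length as) x")
    case True
    then obtain M where M: "is_dfa (set as) M" "x = dfa_code as M"
      using dfa_of_code[OF assms(2)] by blast
    obtain n r where nr: "accepting_ranking (set as) M (run M W n) r \<or>
        rejecting_ranking (set as) M (run M W n) r"
      using ranking_exists[OF W M(1)] by blast
    \<comment> \<open>The ranking is cut down to the states and coded as a list, which
      \<open>ranking_cong\<close> permits.\<close>
    define c where "c = list_encode (map r [0..<nstates M])"
    have "r p = code_nth c p" if "p < nstates M" for p
      using that by (simp add: c_def code_nth_list_encode)
    moreover have "run M W n < nstates M"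
      using M(1) W(1) by (rule run_less_nstates)
    ultimately have "accepting_ranking (set as) M (run M W n) (code_nth c) \<or>
        rejecting_ranking (set as) M (run M W n) (code_nth c)"
      using nr ranking_cong[OF M(1), of "run M W n" r "code_nth c"] by simp
    then have "acc x n c \<or> rej x n c"
      using acc[OF M(1)] rej[OF M(1)] M(2) by blast
    moreover have "n < Suc (max n c)" "c < Suc (max n c)"
      by auto
    ultimately show ?thesis by blast
  qed blast
  have "x \<in> buchi_realizability_problem as W \<longleftrightarrow>
      is_code (length as) x \<and> (\<exists>n<bound x. \<exists>c<bound x. acc x n c)" for x
  proof (cases "is_code (length as) x")
    case False
    then show ?thesis
      using is_code_dfa_code unfolding buchi_realizability_problem_def by blast
  next
    case True
    then obtain M where M: "is_dfa (set as) M" "x = dfa_code as M"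
      using dfa_of_code[OF assms(2)] by blast
    \<comment> \<open>Several automata may share the code \<open>x\<close>, but they have the same
      language, so \<open>M\<close> may stand for all of them.\<close>
    have "x \<in> buchi_realizability_problem as W \<longleftrightarrow> buchi_realizable W (lang (set as) M)"
    proof
      assume "x \<in> buchi_realizability_problem as W"
      then obtain M' where M': "x = dfa_code as M'" "is_dfa (set as) M'"
        "buchi_realizable W (lang (set as) M')"
        unfolding buchi_realizability_problem_def by blast
      have "lang (set as) M = lang (set as) M'"
        using M(1) M'(2) M(2)[unfolded M'(1), symmetric] by (rule dfa_code_determines_lang)
      with M'(3) show "buchi_realizable W (lang (set as) M)" by simp
    next
      assume "buchi_realizable W (lang (set as) M)"
      with M show "x \<in> buchi_realizability_problem as W"
        unfolding buchi_realizability_problem_def by blast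
    qed
    also have "\<dots> \<longleftrightarrow> (\<forall>m. \<exists>n\<ge>m. run M W n \<in> final M)"
      by (rule buchi_realizable_lang_iff[OF W(1)])
    also have "\<dots> \<longleftrightarrow> (\<exists>n<bound x. \<exists>c<bound x. acc x n c)"
    proof
      assume inf: "\<forall>m. \<exists>n\<ge>m. run M W n \<in> final M"
      \<comment> \<open>Soundness of rejecting rankings excludes them here, so the certificate found
        below the bound must be accepting.\<close>
      have "\<not> rej x n c" for n c
        using rejecting_ranking_sound[where W = W, OF W(1) M(1)] inf
        unfolding M(2) rej[OF M(1)] by blast
      moreover have "\<exists>n<bound x. \<exists>c<bound x. acc x n c \<or> rej x n c"
        using LeastI_ex[OF total[of x]] True unfolding bound_def[symmetric] by blast
      ultimately show "\<exists>n<bound x. \<exists>c<bound x. acc x n c"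
        by blast
    next
      assume "\<exists>n<bound x. \<exists>c<bound x. acc x n c"
      then show "\<forall>m. \<exists>n\<ge>m. run M W n \<in> final M"
        using accepting_ranking_sound[where W = W, OF W M(1)]
        unfolding M(2) acc[OF M(1)] by blast
    qed
    finally show ?thesis
      using True by simp
  qed
  moreover have "recursive_pred (\<lambda>e. is_code (length as) (e 0) \<and>
      (\<exists>n<bound (e 0). \<exists>c<bound (e 0). acc (e 0) n c))"
  proof -
    \<comment> \<open>An arbitrary index is needed since the second quantifier's bound lies under
      the first binder, where the input has moved to index 1.\<close>
    have "recursive (\<lambda>e. bound (e i))" for i
      unfolding bound_def acc_def rej_def
      by (rule recursive_Least; (rule total[unfolded acc_def rej_def])?)
        (intro recursive_intros recursive_is_code recursive_code_accepting
          recursive_code_rejecting f(1))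
    then show ?thesis
      unfolding acc_def
      by (intro recursive_intros recursive_is_code recursive_code_accepting f(1))
  qed
  ultimately have "recursive_pred (\<lambda>e. e 0 \<in> buchi_realizability_problem as W)"
    by simp
  then show ?thesis
    unfolding decidable_def recursive_pred_def by (rule computable_if_recursive)
qed

end
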